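(* Let $x$ be a complex number and $n$ a nonnegative integer such that all quantities below are defined. Then \[ \sum_{k=0}^n\binom{2n-k}{n}\binom{x+k}{k}H^2_{k}(x)=\frac{\binom{x+2n+1}{n}}{8} \Big\{4H_{n}^{\langle2\rangle}(x+1)-4H_{n}^{\langle2\rangle}(x+n+1)+8H^2_n(x+n+1) -\big[H_n(\tfrac{x}{2})-H_n(\tfrac{x+1}{2})\big]\big[H_n(\tfrac{x}{2})-H_n(\tfrac{x+1}{2})-\tfrac{4}{x+1}\big]\Big\}. \]
   Context: For a complex $y$ and an integer $k\ge 0$, $\binom{y}{k}=\frac{y(y-1)\cdots(y-k+1)}{k!}$. For complex $x$, integer $n\ge 0$ and positive integer $\ell$: $H_0^{\langle\ell\rangle}(x)=0$, $H_n^{\langle\ell\rangle}(x)=\sum_{k=1}^n\frac{1}{(x+k)^\ell}$, and $H_n(x)=H_n^{\langle1\rangle}(x)$; $H_n^2(x)$ denotes $(H_n(x))^2$. *)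

theory Defs
  imports Complex_Main
begin

text \<open>
  \<open>gharm l n x\<close> is $H_n^{\langle l\rangle}(x)$. Since division by zero yields \<open>0\<close> in HOL,
  the predicate \<open>gharm_defined n x\<close> records that no denominator vanishes (for \<open>l > 0\<close> this
  does not depend on \<open>l\<close>).
\<close>

definition gharm :: "nat \<Rightarrow> nat \<Rightarrow> complex \<Rightarrow> complex" where
  "gharm l n x = (\<Sum>k=1..n. 1 / (x + of_nat k) ^ l)"

definition gharm_defined :: "nat \<Rightarrow> complex \<Rightarrow> bool" where
  "gharm_defined n x \<longleftrightarrow> (\<forall>k\<in>{1..n}. x + of_nat k \<noteq> 0)"

abbreviation harm1 :: "nat \<Rightarrow> complex \<Rightarrow> complex" where
  "harm1 \<equiv> gharm 1"

end

theory Submission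
  imports Defs
begin

text \<open>
  Watson's summation for a terminating 3F2 with parameters \<open>a, b, -n; (a + b + 1) / 2, -2n\<close> has a
  WZ proof. Averaging its instances at \<open>(a + 1, b)\<close> and \<open>(a, b + 1)\<close> evaluates the contiguous sum whose
  lower parameter is \<open>d = (a + b) / 2\<close>. Now put \<open>a = x + 1 + \<alpha> s\<close>, \<open>b = x + 1 + \<beta> s\<close>, \<open>d = x + 1 + s\<close> with
  \<open>\<alpha> + \<beta> = 2\<close> and \<open>\<alpha>\<^sup>2 + \<beta>\<^sup>2 = 1\<close>. At \<open>s = 0\<close> the logarithmic derivative of the \<open>k\<close>-th summand is
  \<open>(\<alpha> + \<beta> - 1) H\<^sub>k(x) = H\<^sub>k(x)\<close>, and the second derivative of its logarithm is a multiple of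
  \<open>\<alpha>\<^sup>2 + \<beta>\<^sup>2 - 1 = 0\<close>. So the second derivative of the sum at \<open>s = 0\<close> is the left-hand side, and that of
  the closed form is the right-hand side.
\<close>

section \<open>Watson's terminating sum and its contiguous variant\<close>

definition watson_term :: "'a::field_char_0 \<Rightarrow> 'a \<Rightarrow> 'a \<Rightarrow> nat \<Rightarrow> 'a" where
  "watson_term a b e k = pochhammer a k * pochhammer b k / (pochhammer e k * fact k)"

lemma watson_term_Suc:
  assumes "e + of_nat k \<noteq> 0"
  shows "of_nat (Suc k) * (e + of_nat k) * watson_term a b e (Suc k) =
           (a + of_nat k) * (b + of_nat k) * watson_term a b e k"
proof -
  have "(of_nat (Suc k) :: 'a) \<noteq> 0" by (simp only: of_nat_neq_0 not_False_eq_True)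
  thus ?thesis using assms
    unfolding watson_term_def pochhammer_Suc fact_Suc
    \<comment> \<open>If an earlier factor of \<open>pochhammer e k\<close> vanishes, both terms are
      0 by the convention on division by zero.\<close>
    by (cases "pochhammer e k = 0") (simp_all add: divide_simps del: of_nat_Suc)
qed

text \<open>\<open>G\<close> is the WZ mate found by Gosper's algorithm, with the denominator \<open>n + 1 - k\<close> of the
  certificate absorbed into the binomial coefficient.\<close>
lemma watson_telescope:
  fixes a b e :: "'a::field_char_0"
  assumes "2 * e = a + b + 1" and "k \<le> n" and "e + of_nat k \<noteq> 0"
  defines "G \<equiv> \<lambda>k. - of_nat ((2 * n + 1 - k) choose n) * of_nat k * (e + of_nat k - 1)
                     * watson_term a b e k"
  shows "of_nat (n + 1) * (e + of_nat n) * (of_nat ((2 * n + 2 - k) choose (n + 1)) * watson_term a b e k)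
           - (a + 1 + 2 * of_nat n) * (b + 1 + 2 * of_nat n)
               * (of_nat ((2 * n - k) choose n) * watson_term a b e k)
         = G (Suc k) - G k"
proof -
  obtain j where n: "n = k + j" using assms(2) le_Suc_ex by blast
  define c where "c = (of_nat ((n + j) choose n) :: 'a)"
  define c1 where "c1 = (of_nat ((n + j + 1) choose n) :: 'a)"
  define c2 where "c2 = (of_nat ((n + j + 2) choose (n + 1)) :: 'a)"
  define t where "t = watson_term a b e k"
  \<comment> \<open>Absorption identities make \<open>c1\<close> and \<open>c2\<close> rational
    multiples of \<open>c\<close>.\<close>
  have "(j + 1) * ((n + j + 1) choose n) = (n + j + 1) * ((n + j) choose n)"
    using binomial_absorb_comp[of "n + j + 1" n] by (simp add: mult.commute)
  hence c1: "of_nat (j + 1) * c1 = of_nat (n + j + 1) * c"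
    unfolding c_def c1_def by (metis of_nat_mult)
  have "(n + 1) * ((n + j + 2) choose (n + 1)) = (n + j + 2) * ((n + j + 1) choose n)"
    using Suc_times_binomial[of n "n + j + 1"] by simp
  hence c2: "of_nat (n + 1) * c2 = of_nat (n + j + 2) * c1"
    unfolding c1_def c2_def by (metis of_nat_mult)
  have j: "(of_nat (j + 1) :: 'a) \<noteq> 0" by (metis Suc_eq_plus1 of_nat_neq_0)
  have b: "b = 2 * e - a - 1" using assms(1) by (simp add: algebra_simps)
  have i: "2 * n + 2 - k = n + j + 2" "2 * n - k = n + j" "2 * n + 1 - k = n + j + 1"
    "2 * n + 1 - Suc k = n + j" using n by auto
  have GS: "G (Suc k) = - c * ((a + of_nat k) * (b + of_nat k) * t)"
    unfolding t_def watson_term_Suc[OF assms(3), symmetric] unfolding G_def i c_def by (simp add: mult_ac)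
  have Gk: "G k = - c1 * of_nat k * (e + of_nat k - 1) * t"
    unfolding G_def i c1_def t_def by simp
  \<comment> \<open>With \<open>c2\<close> traded for \<open>c1\<close>, the factor
    \<open>j + 1\<close> turns \<open>c1\<close> into \<open>c\<close>. Eliminating \<open>b\<close>
    by Watson's condition leaves a polynomial identity times \<open>c\<close>.\<close>
  have poly: "of_nat (j + 1) * (of_nat (n + j + 2) * c1 * (e + of_nat n)
       - (a + 1 + 2 * of_nat n) * (b + 1 + 2 * of_nat n) * c)
      = of_nat (j + 1) * (- c * ((a + of_nat k) * (b + of_nat k)) + c1 * of_nat k * (e + of_nat k - 1))"
  proof -
    have "of_nat (j + 1) * (of_nat (n + j + 2) * c1 * (e + of_nat n)
       - (a + 1 + 2 * of_nat n) * (b + 1 + 2 * of_nat n) * c)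
       = of_nat (n + j + 2) * (of_nat (n + j + 1) * c) * (e + of_nat n)
       - of_nat (j + 1) * (a + 1 + 2 * of_nat n) * (b + 1 + 2 * of_nat n) * c"
      unfolding c1[symmetric] by (simp only: algebra_simps)
    also have "\<dots> = - of_nat (j + 1) * c * ((a + of_nat k) * (b + of_nat k))
         + (of_nat (n + j + 1) * c) * of_nat k * (e + of_nat k - 1)"
      unfolding b n by (simp add: algebra_simps)
    finally show ?thesis
      unfolding c1[symmetric] by (simp only: distrib_left mult_minus_left mult_minus_right mult_ac)
  qed
  have "of_nat (n + 1) * (e + of_nat n) * (c2 * t)
           - (a + 1 + 2 * of_nat n) * (b + 1 + 2 * of_nat n) * (c * t)
      = (of_nat (n + 1) * c2 * (e + of_nat n)
           - (a + 1 + 2 * of_nat n) * (b + 1 + 2 * of_nat n) * c) * t"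
    by (simp only: algebra_simps)
  also have "\<dots> = (- c * ((a + of_nat k) * (b + of_nat k)) + c1 * of_nat k * (e + of_nat k - 1)) * t"
    unfolding c2 using poly j by (metis mult_left_cancel)
  also have "\<dots> = G (Suc k) - G k" unfolding GS Gk by (simp add: algebra_simps)
  finally show ?thesis unfolding i c_def c2_def t_def .
qed

text \<open>For \<open>k \<le> n\<close> the weight is \<open>(2 * n) choose n\<close> times (-n)_k
  / (-2n)_k, so this is Watson's 3F2 at 1. Summing the telescoping identity over k gives a
  first-order recurrence in \<open>n\<close>, which the closed form satisfies as well.\<close>

theorem watson_terminating:
  fixes a b e :: "'a::field_char_0"
  assumes "2 * e = a + b + 1" and "\<And>k. k < n \<Longrightarrow> e + of_nat k \<noteq> 0"
  shows "(\<Sum>k=0..n. of_nat ((2 * n - k) choose n) * watson_term a b e k) =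
           4 ^ n * pochhammer ((a + 1) / 2) n * pochhammer ((b + 1) / 2) n / (fact n * pochhammer e n)"
  using assms(2)
proof (induction n)
  case 0
  show ?case by (simp add: watson_term_def)
next
  case (Suc n)
  define G where "G k = - of_nat ((2 * n + 1 - k) choose n) * of_nat k * (e + of_nat k - 1)
                     * watson_term a b e k" for k
  define S where "S n = (\<Sum>k=0..n. of_nat ((2 * n - k) choose n) * watson_term a b e k)" for n
  have e: "e + of_nat k \<noteq> 0" if "k \<le> n" for k using Suc.prems that by simp
  have n: "(of_nat (Suc n) :: 'a) \<noteq> 0" by (simp only: of_nat_neq_0 not_False_eq_True)
  have "(\<Sum>k=0..n. of_nat (n + 1) * (e + of_nat n) * (of_nat ((2 * n + 2 - k) choose (n + 1)) * watson_term a b e k)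
           - (a + 1 + 2 * of_nat n) * (b + 1 + 2 * of_nat n)
               * (of_nat ((2 * n - k) choose n) * watson_term a b e k)) = (\<Sum>k=0..n. G (Suc k) - G k)"
    unfolding G_def by (intro sum.cong refl watson_telescope assms e) auto
  \<comment> \<open>\<open>G 0\<close> vanishes through its factor \<open>k\<close>, so only the
    upper boundary survives.\<close>
  also have "\<dots> = G (Suc n)"
    by (subst sum_Suc_diff) (auto simp: G_def)
  also have "\<dots> = - of_nat (n + 1) * (e + of_nat n) * watson_term a b e (Suc n)"
    by (simp add: G_def)
  finally have "of_nat (n + 1) * (e + of_nat n)
        * (\<Sum>k=0..n. of_nat ((2 * n + 2 - k) choose (n + 1)) * watson_term a b e k)
      - (a + 1 + 2 * of_nat n) * (b + 1 + 2 * of_nat n) * S n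
      = - of_nat (n + 1) * (e + of_nat n) * watson_term a b e (Suc n)"
    unfolding S_def by (simp only: sum_subtractf sum_distrib_left)
  moreover have "S (Suc n) = (\<Sum>k=0..n. of_nat ((2 * n + 2 - k) choose (n + 1)) * watson_term a b e k)
      + watson_term a b e (Suc n)"
    unfolding S_def by simp
  \<comment> \<open>The boundary value cancels the new summand k = n + 1, whose weight is 1.\<close>
  ultimately have "of_nat (Suc n) * (e + of_nat n) * S (Suc n)
      = (a + 1 + 2 * of_nat n) * (b + 1 + 2 * of_nat n) * S n"
    by (simp add: algebra_simps)
  also have "\<dots> = 4 * ((a + 1) / 2 + of_nat n) * ((b + 1) / 2 + of_nat n) * S n"
    by (simp add: field_simps)
  finally have rec: "S (Suc n) = 4 * ((a + 1) / 2 + of_nat n) * ((b + 1) / 2 + of_nat n) * S n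
      / (of_nat (Suc n) * (e + of_nat n))"
    using n e[of n] by (simp add: nonzero_eq_divide_eq mult.commute del: of_nat_Suc)
  have "S n = 4 ^ n * pochhammer ((a + 1) / 2) n * pochhammer ((b + 1) / 2) n / (fact n * pochhammer e n)"
    unfolding S_def by (rule Suc.IH) (use Suc.prems in auto)
  thus ?case unfolding S_def[symmetric] rec pochhammer_Suc fact_Suc power_Suc
    by (simp add: ac_simps del: of_nat_Suc)
qed

text \<open>By a (a + 1)_k = (a)_k (a + k) and its analogue for b, the two numerators add up to
  (a)_k (b)_k (a + b + 2k). Here a + b + 2k = 2 (d + k), and (d + 1)_k = (d)_k (d + k) / d absorbs
  it.\<close>

lemma watson_term_contiguous:
  fixes a b d :: "'a::field_char_0"
  assumes "2 * d = a + b" and "d \<noteq> 0" and "d + of_nat k \<noteq> 0"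
  shows "2 * d * watson_term a b d k =
           a * watson_term (a + 1) b (d + 1) k + b * watson_term a (b + 1) (d + 1) k"
proof -
  have shift: "y * pochhammer (y + 1) k = pochhammer y k * (y + of_nat k)" for y :: 'a
    by (metis pochhammer_Suc pochhammer_rec)
  have d: "pochhammer (d + 1) k = pochhammer d k * (d + of_nat k) / d"
    using shift[of d] assms(2) by (simp add: field_simps)
  have "a * watson_term (a + 1) b (d + 1) k + b * watson_term a (b + 1) (d + 1) k
      = ((a * pochhammer (a + 1) k) * pochhammer b k + pochhammer a k * (b * pochhammer (b + 1) k))
          / (pochhammer (d + 1) k * fact k)"
    unfolding watson_term_def by (simp add: add_divide_distrib mult_ac)
  also have "\<dots> = pochhammer a k * pochhammer b k * (2 * (d + of_nat k)) / (pochhammer (d + 1) k * fact k)"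
    unfolding shift using assms(1) by (simp add: algebra_simps flip: distrib_left)
  also have "\<dots> = 2 * d * watson_term a b d k"
    unfolding watson_term_def d using assms(2,3) by (cases "pochhammer d k = 0") (simp_all add: divide_simps)
  finally show ?thesis ..
qed

text \<open>Both (a + 1, b) and (a, b + 1) meet Watson's condition with lower parameter d + 1. The
  factors a / 2, b / 2 and d then lengthen Pochhammer symbols from n to n + 1 factors. The two
  resulting products differ by swapping a and b, so one derivative computation serves both.\<close>

theorem watson_contiguous:
  fixes a b d :: "'a::field_char_0"
  assumes "2 * d = a + b" and nz: "\<And>k. k \<le> n \<Longrightarrow> d + of_nat k \<noteq> 0"
  shows "(\<Sum>k=0..n. of_nat ((2 * n - k) choose n) * watson_term a b d k) =
           4 ^ n / fact n * (pochhammer (a / 2) (Suc n) * pochhammer ((b + 1) / 2) n / pochhammer d (Suc n))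
         + 4 ^ n / fact n * (pochhammer (b / 2) (Suc n) * pochhammer ((a + 1) / 2) n / pochhammer d (Suc n))"
proof -
  have d: "d \<noteq> 0" using nz[of 0] by simp
  have nz': "d + 1 + of_nat k \<noteq> 0" if "k < n" for k
    using nz[of "Suc k"] that by (simp add: add_ac)
  have "2 * d * (\<Sum>k=0..n. of_nat ((2 * n - k) choose n) * watson_term a b d k)
      = (\<Sum>k=0..n. of_nat ((2 * n - k) choose n) * (2 * d * watson_term a b d k))"
    by (simp add: sum_distrib_left mult_ac)
  also have "\<dots> = (\<Sum>k=0..n. of_nat ((2 * n - k) choose n) *
        (a * watson_term (a + 1) b (d + 1) k + b * watson_term a (b + 1) (d + 1) k))"
    by (intro sum.cong refl arg_cong2[where f = "(*)"] watson_term_contiguous assms d nz) auto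
  also have "\<dots> = a * (\<Sum>k=0..n. of_nat ((2 * n - k) choose n) * watson_term (a + 1) b (d + 1) k)
                + b * (\<Sum>k=0..n. of_nat ((2 * n - k) choose n) * watson_term a (b + 1) (d + 1) k)"
    by (simp add: sum_distrib_left sum.distrib distrib_left mult_ac)
  also have "\<dots> = a * (4 ^ n * pochhammer (a / 2 + 1) n * pochhammer ((b + 1) / 2) n / (fact n * pochhammer (d + 1) n))
                + b * (4 ^ n * pochhammer ((a + 1) / 2) n * pochhammer (b / 2 + 1) n / (fact n * pochhammer (d + 1) n))"
  proof -
    have *: "a / 2 + 1 = (a + 1 + 1) / 2" "b / 2 + 1 = (b + 1 + 1) / 2" by (simp_all add: field_simps)
    have "2 * (d + 1) = a + 1 + b + 1" "2 * (d + 1) = a + (b + 1) + 1"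
      using assms(1) by (simp_all add: algebra_simps)
    thus ?thesis unfolding * by (simp only: watson_terminating[OF _ nz'])
  qed
  finally have "(\<Sum>k=0..n. of_nat ((2 * n - k) choose n) * watson_term a b d k)
      = (a * (4 ^ n * pochhammer (a / 2 + 1) n * pochhammer ((b + 1) / 2) n / (fact n * pochhammer (d + 1) n))
       + b * (4 ^ n * pochhammer ((a + 1) / 2) n * pochhammer (b / 2 + 1) n / (fact n * pochhammer (d + 1) n)))
        / (2 * d)"
    using d by (simp add: nonzero_eq_divide_eq mult.commute)
  thus ?thesis
    unfolding pochhammer_rec[of _ n] by (simp add: add_divide_distrib mult_ac)
qed

text \<open>Legendre's duplication for an odd number of factors: halving each 2z + i separates the n
  + 1 even indices i from the n odd ones.\<close>

lemma pochhammer_double_Suc: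
  fixes z :: "'a::field_char_0"
  shows "pochhammer (2 * z) (2 * n + 1) = 2 * 4 ^ n * pochhammer z (Suc n) * pochhammer (z + 1 / 2) n"
  by (induction n) (simp_all add: pochhammer_Suc field_simps)

section \<open>Second derivatives at 0 through logarithmic jets\<close>

text \<open>The second derivative is taken at 0.\<close>
definition second_deriv :: "(complex \<Rightarrow> complex) \<Rightarrow> complex \<Rightarrow> bool" where
  "second_deriv f c \<longleftrightarrow> (\<exists>g. (\<forall>\<^sub>F s in nhds 0. (f has_field_derivative g s) (at s)) \<and>
      (g has_field_derivative c) (at 0))"

text \<open>\<open>l\<close> and \<open>m\<close> are the first and second derivatives of \<open>ln f\<close> at 0; both are additive under products.\<close>
definition log_jet :: "(complex \<Rightarrow> complex) \<Rightarrow> complex \<Rightarrow> complex \<Rightarrow> bool" where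
  "log_jet f l m \<longleftrightarrow> (\<exists>g. (\<forall>\<^sub>F s in nhds 0. (f has_field_derivative f s * g s) (at s)) \<and>
      g 0 = l \<and> (g has_field_derivative m) (at 0))"

text \<open>First derivatives exist on a neighbourhood, so agreement of the functions near 0 passes
  to the first derivatives near 0 and from there to the second derivatives at 0.\<close>

lemma second_deriv_unique:
  assumes "second_deriv f c" and "second_deriv g d" and "\<forall>\<^sub>F s in nhds 0. f s = g s"
  shows "c = d"
proof -
  obtain f' where f': "\<forall>\<^sub>F s in nhds 0. (f has_field_derivative f' s) (at s)"
      "(f' has_field_derivative c) (at 0)"
    using assms(1) unfolding second_deriv_def by blast
  obtain g' where g': "\<forall>\<^sub>F s in nhds 0. (g has_field_derivative g' s) (at s)"
      "(g' has_field_derivative d) (at 0)"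
    using assms(2) unfolding second_deriv_def by blast
  have "\<forall>\<^sub>F s in nhds 0. \<forall>\<^sub>F t in nhds s. f t = g t"
    using assms(3) by (simp add: eventually_eventually)
  hence "\<forall>\<^sub>F s in nhds 0. f' s = g' s"
    using f'(1) g'(1)
  proof eventually_elim
    case (elim s)
    thus ?case using DERIV_cong_ev[OF refl elim(1) refl] DERIV_unique by blast
  qed
  thus ?thesis using DERIV_cong_ev[OF refl _ refl] f'(2) g'(2) DERIV_unique by blast
qed

lemma second_deriv_add:
  assumes "second_deriv f c" and "second_deriv g d"
  shows "second_deriv (\<lambda>s. f s + g s) (c + d)"
proof -
  obtain f' where f': "\<forall>\<^sub>F s in nhds 0. (f has_field_derivative f' s) (at s)"
      "(f' has_field_derivative c) (at 0)"
    using assms(1) unfolding second_deriv_def by blast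
  obtain g' where g': "\<forall>\<^sub>F s in nhds 0. (g has_field_derivative g' s) (at s)"
      "(g' has_field_derivative d) (at 0)"
    using assms(2) unfolding second_deriv_def by blast
  have "\<forall>\<^sub>F s in nhds 0. ((\<lambda>s. f s + g s) has_field_derivative f' s + g' s) (at s)"
    using f'(1) g'(1) by eventually_elim (rule DERIV_add)
  thus ?thesis unfolding second_deriv_def using DERIV_add[OF f'(2) g'(2)]
    by (intro exI[of _ "\<lambda>s. f' s + g' s"]) auto
qed

lemma second_deriv_sum:
  assumes "finite I" and "\<And>i. i \<in> I \<Longrightarrow> second_deriv (f i) (c i)"
  shows "second_deriv (\<lambda>s. \<Sum>i\<in>I. f i s) (\<Sum>i\<in>I. c i)"
  using assms
proof (induction I rule: finite_induct)
  case empty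
  show ?case unfolding second_deriv_def by (auto intro!: exI[of _ "\<lambda>_. 0"])
next
  case (insert i I)
  thus ?case by (simp add: second_deriv_add)
qed

text \<open>From f' = f g follows f'' = f (g^2 + g').\<close>

lemma log_jet_second_deriv:
  assumes "log_jet f l m"
  shows "second_deriv f (f 0 * (l\<^sup>2 + m))"
proof -
  obtain g where g: "\<forall>\<^sub>F s in nhds 0. (f has_field_derivative f s * g s) (at s)"
      "g 0 = l" "(g has_field_derivative m) (at 0)"
    using assms unfolding log_jet_def by blast
  have "((\<lambda>s. f s * g s) has_field_derivative f 0 * (l\<^sup>2 + m)) (at 0)"
    using eventually_nhds_x_imp_x[OF g(1)] g(2,3)
    by (auto intro!: derivative_eq_intros simp: power2_eq_square algebra_simps)
  thus ?thesis unfolding second_deriv_def using g(1)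
    by (intro exI[of _ "\<lambda>s. f s * g s"]) auto
qed

text \<open>The relation f' = f g involves neither a logarithm nor a division, so even
  \<open>c = 0\<close> is covered.\<close>

lemma log_jet_const: "log_jet (\<lambda>_. c) 0 0"
  unfolding log_jet_def by (auto intro!: exI[of _ "\<lambda>_. 0"])

lemma log_jet_mult:
  assumes "log_jet f l m" and "log_jet g l' m'"
  shows "log_jet (\<lambda>s. f s * g s) (l + l') (m + m')"
proof -
  obtain u where u: "\<forall>\<^sub>F s in nhds 0. (f has_field_derivative f s * u s) (at s)"
      "u 0 = l" "(u has_field_derivative m) (at 0)"
    using assms(1) unfolding log_jet_def by blast
  obtain v where v: "\<forall>\<^sub>F s in nhds 0. (g has_field_derivative g s * v s) (at s)"
      "v 0 = l'" "(v has_field_derivative m') (at 0)"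
    using assms(2) unfolding log_jet_def by blast
  have "\<forall>\<^sub>F s in nhds 0. ((\<lambda>s. f s * g s) has_field_derivative f s * g s * (u s + v s)) (at s)"
    using u(1) v(1)
    by eventually_elim (auto intro!: derivative_eq_intros simp: algebra_simps)
  thus ?thesis unfolding log_jet_def using DERIV_add[OF u(3) v(3)] u(2) v(2)
    by (intro exI[of _ "\<lambda>s. u s + v s"]) auto
qed

lemma log_jet_inverse:
  assumes "log_jet f l m" and "f 0 \<noteq> 0"
  shows "log_jet (\<lambda>s. inverse (f s)) (- l) (- m)"
proof -
  obtain u where u: "\<forall>\<^sub>F s in nhds 0. (f has_field_derivative f s * u s) (at s)"
      "u 0 = l" "(u has_field_derivative m) (at 0)"
    using assms(1) unfolding log_jet_def by blast
  \<comment> \<open>Continuity spreads \<open>f 0 \<noteq> 0\<close> to a neighbourhood, where the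
    reciprocal can be differentiated.\<close>
  have "isCont f 0" using eventually_nhds_x_imp_x[OF u(1)] by (rule DERIV_isCont)
  hence "\<forall>\<^sub>F s in nhds 0. f s \<noteq> 0"
    using assms(2) by (intro tendsto_imp_eventually_ne) (auto simp: isCont_def tendsto_at_iff_tendsto_nhds)
  with u(1) have "\<forall>\<^sub>F s in nhds 0.
      ((\<lambda>s. inverse (f s)) has_field_derivative inverse (f s) * (- u s)) (at s)"
    by eventually_elim (auto intro!: derivative_eq_intros simp: field_simps)
  thus ?thesis unfolding log_jet_def using DERIV_minus[OF u(3)] u(2)
    by (intro exI[of _ "\<lambda>s. - u s"]) auto
qed

lemma log_jet_divide:
  assumes "log_jet f l m" and "log_jet g l' m'" and "g 0 \<noteq> 0"
  shows "log_jet (\<lambda>s. f s / g s) (l - l') (m - m')"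
  using log_jet_mult[OF assms(1) log_jet_inverse[OF assms(2,3)]] by (simp add: divide_inverse)

lemma log_jet_linear:
  assumes "u \<noteq> 0"
  shows "log_jet (\<lambda>s. u + v * s) (v / u) (- v\<^sup>2 / u\<^sup>2)"
proof -
  have "((\<lambda>s. u + v * s) \<longlongrightarrow> u + v * 0) (nhds 0)"
    by (intro tendsto_intros filterlim_ident)
  hence "\<forall>\<^sub>F s in nhds 0. u + v * s \<noteq> 0"
    using assms by (intro tendsto_imp_eventually_ne) auto
  hence "\<forall>\<^sub>F s in nhds 0. ((\<lambda>s. u + v * s) has_field_derivative (u + v * s) * (v / (u + v * s))) (at s)"
    by eventually_elim (auto intro!: derivative_eq_intros)
  moreover have "((\<lambda>s. v / (u + v * s)) has_field_derivative - v\<^sup>2 / u\<^sup>2) (at 0)"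
    using assms by (auto intro!: derivative_eq_intros simp: power2_eq_square)
  ultimately show ?thesis unfolding log_jet_def
    by (intro exI[of _ "\<lambda>s. v / (u + v * s)"]) auto
qed

section \<open>Harmonic sums as logarithmic jets of Pochhammer symbols\<close>

lemma gharm_Suc: "gharm l (Suc n) x = gharm l n x + 1 / (x + of_nat (Suc n)) ^ l"
  by (simp add: gharm_def)

lemma gharm_Suc_left: "gharm l (Suc n) x = 1 / (x + 1) ^ l + gharm l n (x + 1)"
  by (induction n) (simp_all add: gharm_def add_ac)

lemma gharm_add: "gharm l (m + n) x = gharm l m x + gharm l n (x + of_nat m)"
  by (induction n) (simp_all add: gharm_def add_ac)

text \<open>Doubled denominators are x + 2k - 1 in the first sum and x + 2k in the second; together
  they run through x + 1, ..., x + 2n + 1.\<close>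

lemma gharm_double:
  "gharm l (Suc n) ((x - 1) / 2) + gharm l n (x / 2) = 2 ^ l * gharm l (2 * n + 1) x"
proof (induction n)
  case 0
  have "1 / ((x - 1) / 2 + 1) ^ l = 1 / ((x + 1) / 2) ^ l" by (simp add: field_simps)
  thus ?case by (simp add: gharm_def power_divide)
next
  case (Suc n)
  have "(x - 1) / 2 + of_nat (Suc (Suc n)) = (x + of_nat (2 * n + 3)) / 2"
    "x / 2 + of_nat (Suc n) = (x + of_nat (2 * n + 2)) / 2" by (simp_all add: field_simps)
  hence "gharm l (Suc (Suc n)) ((x - 1) / 2) + gharm l (Suc n) (x / 2)
      = gharm l (Suc n) ((x - 1) / 2) + gharm l n (x / 2)
        + 2 ^ l / (x + of_nat (2 * n + 2)) ^ l + 2 ^ l / (x + of_nat (2 * n + 3)) ^ l"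
    by (simp only: gharm_Suc[of l "Suc n" "(x - 1) / 2"] gharm_Suc[of l n "x / 2"] power_divide) simp
  also have "\<dots> = 2 ^ l * (gharm l (2 * n + 1) x + 1 / (x + of_nat (2 * n + 2)) ^ l
        + 1 / (x + of_nat (2 * n + 3)) ^ l)"
    unfolding Suc.IH by (simp add: distrib_left)
  also have "\<dots> = 2 ^ l * gharm l (2 * Suc n + 1) x"
  proof -
    have "2 * Suc n + 1 = Suc (Suc (2 * n + 1))" "2 * n + 2 = Suc (2 * n + 1)"
      "2 * n + 3 = Suc (Suc (2 * n + 1))" by simp_all
    thus ?thesis by (simp only: gharm_Suc)
  qed
  finally show ?case .
qed

lemma gharm_defined_pochhammer: "gharm_defined n u \<longleftrightarrow> pochhammer (u + 1) n \<noteq> 0"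
proof (induction n)
  case 0
  show ?case by (simp add: gharm_defined_def)
next
  case (Suc n)
  have "gharm_defined (Suc n) u \<longleftrightarrow> gharm_defined n u \<and> u + of_nat (Suc n) \<noteq> 0"
    unfolding gharm_defined_def by (simp add: atLeastAtMostSuc_conv conj_commute)
  thus ?case using Suc.IH by (simp add: pochhammer_Suc add_ac)
qed

text \<open>Jets add over the linear factors u + k + v s with k from 1 to n, each contributing v /
  (u + k) and -v^2 / (u + k)^2.\<close>

lemma log_jet_pochhammer:
  assumes "gharm_defined n u"
  shows "log_jet (\<lambda>s. pochhammer (u + 1 + v * s) n) (v * harm1 n u) (- v\<^sup>2 * gharm 2 n u)"
  using assms
proof (induction n)
  case 0
  show ?case by (simp add: gharm_def log_jet_const)
next
  case (Suc n)
  have "gharm_defined n u" "u + of_nat (Suc n) \<noteq> 0"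
    using Suc.prems by (simp_all add: gharm_defined_pochhammer pochhammer_Suc add_ac)
  hence "log_jet (\<lambda>s. pochhammer (u + 1 + v * s) n * (u + of_nat (Suc n) + v * s))
     (v * harm1 n u + v / (u + of_nat (Suc n))) (- v\<^sup>2 * gharm 2 n u + - v\<^sup>2 / (u + of_nat (Suc n))\<^sup>2)"
    by (intro log_jet_mult log_jet_linear Suc.IH)
  thus ?case by (simp add: gharm_Suc pochhammer_Suc algebra_simps)
qed

section \<open>Second derivatives of the summand and of the closed form\<close>

lemma second_deriv_watson_term:
  assumes "gharm_defined k x" and "\<alpha> + \<beta> = 2" and "\<alpha>\<^sup>2 + \<beta>\<^sup>2 = 1"
  shows "second_deriv (\<lambda>s. c * watson_term (x + 1 + \<alpha> * s) (x + 1 + \<beta> * s) (x + 1 + s) k)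
           (c * ((x + of_nat k) gchoose k) * (harm1 k x)\<^sup>2)"
proof -
  \<comment> \<open>The coefficients \<alpha>, \<beta> and 1 are the speeds of the three parameters.
    \<open>1 *\<close> and \<open>0 +\<close> stay unsimplified so that the jet rules match
    literally.\<close>
  let ?f = "\<lambda>s. c / fact k * (pochhammer (x + 1 + \<alpha> * s) k * pochhammer (x + 1 + \<beta> * s) k
              / pochhammer (x + 1 + 1 * s) k)"
  let ?l = "0 + (\<alpha> * harm1 k x + \<beta> * harm1 k x - 1 * harm1 k x)"
  let ?m = "0 + (- \<alpha>\<^sup>2 * gharm 2 k x + - \<beta>\<^sup>2 * gharm 2 k x - - 1\<^sup>2 * gharm 2 k x)"
  have nz: "pochhammer (x + 1) k \<noteq> 0" using assms(1) by (simp add: gharm_defined_pochhammer)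
  have jet: "log_jet ?f ?l ?m"
    using nz by (intro log_jet_mult log_jet_divide log_jet_const log_jet_pochhammer assms(1)) simp
  have l: "?l = harm1 k x"
  proof -
    have "?l = (\<alpha> + \<beta> - 1) * harm1 k x" by (simp add: algebra_simps)
    thus ?thesis using assms(2) by simp
  qed
  have m: "?m = 0"
  proof -
    have "?m = (1 - (\<alpha>\<^sup>2 + \<beta>\<^sup>2)) * gharm 2 k x" by (simp add: algebra_simps)
    thus ?thesis using assms(3) by simp
  qed
  have "second_deriv ?f (?f 0 * ((harm1 k x)\<^sup>2 + 0))"
    using log_jet_second_deriv[OF jet] unfolding l m .
  moreover have f0: "?f 0 = c * ((x + of_nat k) gchoose k)"
    using nz by (simp add: gbinomial_pochhammer')
  moreover have f: "?f = (\<lambda>s. c * watson_term (x + 1 + \<alpha> * s) (x + 1 + \<beta> * s) (x + 1 + s) k)"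
    by (simp add: watson_term_def mult_ac)
  ultimately show ?thesis unfolding f0 f by simp
qed

text \<open>Halved parameters give the speeds \<alpha> / 2 and \<beta> / 2 and the base points (x -
  1) / 2 and x / 2. Arbitrary \<alpha> and \<beta> allow a second use with the two
  exchanged.\<close>

lemma second_deriv_watson_value:
  assumes "gharm_defined (Suc n) x" and "gharm_defined (Suc n) ((x - 1) / 2)" and "gharm_defined n (x / 2)"
  shows "second_deriv (\<lambda>s. 4 ^ n / fact n * (pochhammer ((x + 1 + \<alpha> * s) / 2) (Suc n)
             * pochhammer ((x + 1 + \<beta> * s + 1) / 2) n / pochhammer (x + 1 + s) (Suc n)))
     (((x + 2 * of_nat n + 1) gchoose n) / 2 *
       ((\<alpha> / 2 * harm1 (Suc n) ((x - 1) / 2) + \<beta> / 2 * harm1 n (x / 2) - harm1 (Suc n) x)\<^sup>2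
         - (\<alpha>\<^sup>2 / 4 * gharm 2 (Suc n) ((x - 1) / 2) + \<beta>\<^sup>2 / 4 * gharm 2 n (x / 2) - gharm 2 (Suc n) x)))"
proof -
  let ?f = "\<lambda>s. 4 ^ n / fact n * (pochhammer ((x - 1) / 2 + 1 + \<alpha> / 2 * s) (Suc n)
       * pochhammer (x / 2 + 1 + \<beta> / 2 * s) n / pochhammer (x + 1 + 1 * s) (Suc n))"
  let ?l = "0 + (\<alpha> / 2 * harm1 (Suc n) ((x - 1) / 2) + \<beta> / 2 * harm1 n (x / 2) - 1 * harm1 (Suc n) x)"
  let ?m = "0 + (- (\<alpha> / 2)\<^sup>2 * gharm 2 (Suc n) ((x - 1) / 2) + - (\<beta> / 2)\<^sup>2 * gharm 2 n (x / 2)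
              - - 1\<^sup>2 * gharm 2 (Suc n) x)"
  have nz: "pochhammer (x + 1) (Suc n) \<noteq> 0" using assms(1) by (simp add: gharm_defined_pochhammer)
  have "log_jet ?f ?l ?m"
    using nz by (intro log_jet_mult log_jet_divide log_jet_const log_jet_pochhammer assms) simp
  hence "second_deriv ?f (?f 0 * (?l\<^sup>2 + ?m))" by (rule log_jet_second_deriv)
  moreover have f0: "?f 0 = ((x + 2 * of_nat n + 1) gchoose n) / 2"
  proof -
    \<comment> \<open>(x + 1)_(2n+1) is split in two ways, after n + 1 factors and by duplication;
      comparing them leaves (x + n + 2)_n / n!, the binomial coefficient, with a factor 1/2.\<close>
    have "pochhammer (x + 1) (Suc n) * pochhammer (x + 2 + of_nat n) n = pochhammer (x + 1) (2 * n + 1)"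
      using pochhammer_product'[of "x + 1" "Suc n" n] by (simp add: add_ac mult_2)
    also have "\<dots> = 2 * (4 ^ n * pochhammer ((x + 1) / 2) (Suc n) * pochhammer (x / 2 + 1) n)"
      using pochhammer_double_Suc[of "(x + 1) / 2" n] by (simp add: add_divide_distrib add_ac mult_ac)
    finally have val: "4 ^ n * pochhammer ((x + 1) / 2) (Suc n) * pochhammer (x / 2 + 1) n
        = pochhammer (x + 1) (Suc n) * (pochhammer (x + 2 + of_nat n) n / 2)" by simp
    have "?f 0 = 4 ^ n * pochhammer ((x + 1) / 2) (Suc n) * pochhammer (x / 2 + 1) n
        / (pochhammer (x + 1) (Suc n) * fact n)"
    proof -
      have "(x - 1) / 2 + 1 = (x + 1) / 2" by (simp add: field_simps)
      hence "pochhammer ((x - 1) / 2 + 1 + \<alpha> / 2 * 0) (Suc n) = pochhammer ((x + 1) / 2) (Suc n)"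
        by (simp only: mult_zero_right add_0_right)
      thus ?thesis by (simp add: mult_ac)
    qed
    also have "\<dots> = pochhammer (x + 2 + of_nat n) n / fact n / 2"
      unfolding val using nz by simp
    finally show ?thesis by (simp add: gbinomial_pochhammer' algebra_simps)
  qed
  moreover have f: "?f = (\<lambda>s. 4 ^ n / fact n * (pochhammer ((x + 1 + \<alpha> * s) / 2) (Suc n)
             * pochhammer ((x + 1 + \<beta> * s + 1) / 2) n / pochhammer (x + 1 + s) (Suc n)))"
  proof -
    have "(x + 1 + \<alpha> * s) / 2 = (x - 1) / 2 + 1 + \<alpha> / 2 * s"
      "(x + 1 + \<beta> * s + 1) / 2 = x / 2 + 1 + \<beta> / 2 * s" for s by (simp_all add: field_simps)
    thus ?thesis by (simp only: mult_1_left)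
  qed
  moreover have lm: "?l\<^sup>2 + ?m = (\<alpha> / 2 * harm1 (Suc n) ((x - 1) / 2) + \<beta> / 2 * harm1 n (x / 2) - harm1 (Suc n) x)\<^sup>2
         - (\<alpha>\<^sup>2 / 4 * gharm 2 (Suc n) ((x - 1) / 2) + \<beta>\<^sup>2 / 4 * gharm 2 n (x / 2) - gharm 2 (Suc n) x)"
    by (simp add: power_divide)
  ultimately show ?thesis unfolding f0 f lm by simp
qed

section \<open>Comparison of second derivatives and reduction to the stated harmonic sums\<close>

theorem theorem7:
  fixes x :: complex and n :: nat
  assumes "\<forall>k\<in>{0..n}. gharm_defined k x"
    and "gharm_defined n (x + 1)"
    and "gharm_defined n (x + of_nat n + 1)"
    and "gharm_defined n (x / 2)"
    and "gharm_defined n ((x + 1) / 2)"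
    and "x + 1 \<noteq> 0"
  shows "(\<Sum>k=0..n. ((2 * of_nat n - of_nat k) gchoose n) * ((x + of_nat k) gchoose k)
             * (harm1 k x)\<^sup>2) =
         ((x + 2 * of_nat n + 1) gchoose n) / 8 *
           (4 * gharm 2 n (x + 1) - 4 * gharm 2 n (x + of_nat n + 1)
            + 8 * (harm1 n (x + of_nat n + 1))\<^sup>2
            - (harm1 n (x / 2) - harm1 n ((x + 1) / 2))
              * (harm1 n (x / 2) - harm1 n ((x + 1) / 2) - 4 / (x + 1)))"
proof -
  \<comment> \<open>1 + \<delta> and 1 - \<delta> have sum 2 and square sum 2 + 2 \<delta>^2, which
    is 1 exactly when \<delta>^2 = -1/2; no real direction would do.\<close>
  define \<delta> where "\<delta> = csqrt (- 1 / 2)"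
  define \<alpha> where "\<alpha> = 1 + \<delta>"
  define \<beta> where "\<beta> = 1 - \<delta>"
  have \<delta>: "\<delta>\<^sup>2 = - 1 / 2" unfolding \<delta>_def by (rule power2_csqrt)
  have \<alpha>\<beta>: "\<alpha> + \<beta> = 2" "\<alpha>\<^sup>2 + \<beta>\<^sup>2 = 1" "\<beta>\<^sup>2 + \<alpha>\<^sup>2 = 1"
    using \<delta> by (simp_all add: \<alpha>_def \<beta>_def power2_sum power2_diff)
  have gd: "gharm_defined k x" if "k \<le> n" for k using assms(1) that by simp
  \<comment> \<open>The closed form has Pochhammer symbols of n + 1 factors; the additional first
    factor is x + 1 here and (x + 1) / 2 in \<open>gd2\<close>.\<close>
  have gd1: "gharm_defined (Suc n) x"
    using assms(2,6) by (simp add: gharm_defined_pochhammer pochhammer_rec)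
  have eq: "(x - 1) / 2 + 1 = (x + 1) / 2" by (simp add: field_simps)
  have gd2: "gharm_defined (Suc n) ((x - 1) / 2)"
    using assms(5,6) by (simp add: gharm_defined_pochhammer pochhammer_rec eq)
  define L where "L s = (\<Sum>k=0..n. of_nat ((2 * n - k) choose n)
      * watson_term (x + 1 + \<alpha> * s) (x + 1 + \<beta> * s) (x + 1 + s) k)" for s
  define R where "R \<alpha> \<beta> s = 4 ^ n / fact n * (pochhammer ((x + 1 + \<alpha> * s) / 2) (Suc n)
      * pochhammer ((x + 1 + \<beta> * s + 1) / 2) n / pochhammer (x + 1 + s) (Suc n))" for \<alpha> \<beta> s
  define c where "c \<alpha> \<beta> = (\<alpha> / 2 * harm1 (Suc n) ((x - 1) / 2) + \<beta> / 2 * harm1 n (x / 2) - harm1 (Suc n) x)\<^sup>2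
      - (\<alpha>\<^sup>2 / 4 * gharm 2 (Suc n) ((x - 1) / 2) + \<beta>\<^sup>2 / 4 * gharm 2 n (x / 2) - gharm 2 (Suc n) x)" for \<alpha> \<beta>
  define B where "B = ((x + 2 * of_nat n + 1) gchoose n)"
  have "second_deriv L (\<Sum>k=0..n. of_nat ((2 * n - k) choose n) * ((x + of_nat k) gchoose k) * (harm1 k x)\<^sup>2)"
    unfolding L_def by (intro second_deriv_sum second_deriv_watson_term gd \<alpha>\<beta>) auto
  moreover have "second_deriv (\<lambda>s. R \<alpha> \<beta> s + R \<beta> \<alpha> s) (B / 2 * c \<alpha> \<beta> + B / 2 * c \<beta> \<alpha>)"
    unfolding R_def B_def c_def by (intro second_deriv_add second_deriv_watson_value gd1 gd2 assms(4))
  \<comment> \<open>The finitely many denominators x + 1 + s + k are nonzero at s = 0, hence also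
    for all s near 0, where the contiguous sum applies.\<close>
  moreover have "\<forall>\<^sub>F s in nhds 0. L s = R \<alpha> \<beta> s + R \<beta> \<alpha> s"
  proof -
    have "\<forall>\<^sub>F s in nhds 0. x + 1 + s + of_nat k \<noteq> 0" if "k \<in> {..n}" for k
    proof -
      have "((\<lambda>s. x + 1 + s + of_nat k) \<longlongrightarrow> x + 1 + 0 + of_nat k) (nhds 0)"
        by (intro tendsto_intros filterlim_ident)
      moreover have "x + 1 + 0 + of_nat k \<noteq> 0"
        using gd1 that unfolding gharm_defined_def by (auto simp: add_ac dest!: bspec[of _ _ "Suc k"])
      ultimately show ?thesis by (rule tendsto_imp_eventually_ne)
    qed
    hence "\<forall>\<^sub>F s in nhds 0. \<forall>k\<in>{..n}. x + 1 + s + of_nat k \<noteq> 0"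
      by (intro eventually_ball_finite) auto
    thus ?thesis
    proof eventually_elim
      case (elim s)
      have "2 * (x + 1 + s) = x + 1 + \<alpha> * s + (x + 1 + \<beta> * s)"
        by (simp add: \<alpha>_def \<beta>_def algebra_simps)
      thus ?case unfolding L_def R_def by (rule watson_contiguous) (use elim in auto)
    qed
  qed
  ultimately have main: "(\<Sum>k=0..n. of_nat ((2 * n - k) choose n) * ((x + of_nat k) gchoose k) * (harm1 k x)\<^sup>2)
      = B / 2 * c \<alpha> \<beta> + B / 2 * c \<beta> \<alpha>"
    by (rule second_deriv_unique)
  define V where "V = harm1 n (x / 2)"
  define U where "U = harm1 n ((x + 1) / 2)"
  \<comment> \<open>\<open>p\<close> is the first term of
    \<open>harm1 (Suc n) ((x - 1) / 2)\<close>; the 4 / (x + 1) of the statement is 2p.\<close>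
  define p where "p = 2 / (x + 1)"
  define N where "N = harm1 n (x + of_nat n + 1)"
  define N2 where "N2 = gharm 2 n (x + of_nat n + 1)"
  define K where "K = harm1 (Suc n) x"
  define K2 where "K2 = gharm 2 n (x + 1)"
  have A: "harm1 (Suc n) ((x - 1) / 2) = p + U"
    unfolding p_def U_def by (simp add: gharm_Suc_left eq)
  \<comment> \<open>The doubled sum of 2n + 1 terms is cut after n + 1 terms, and the other n terms
    start from x + n + 1.\<close>
  have split: "gharm l (Suc n) ((x - 1) / 2) + gharm l n (x / 2)
      = 2 ^ l * (gharm l (Suc n) x + gharm l n (x + of_nat n + 1))" for l
    using gharm_add[of l "Suc n" n x] unfolding gharm_double by (simp add: add_ac mult_2)
  have UV: "p + U = 2 * (K + N) - V"
    using split[of 1] unfolding A K_def N_def V_def by (simp add: algebra_simps)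
  have K2': "gharm 2 (Suc n) x = p\<^sup>2 / 4 + K2"
    unfolding K2_def p_def by (simp add: gharm_Suc_left power_divide)
  have Q: "gharm 2 (Suc n) ((x - 1) / 2) + gharm 2 n (x / 2) = 4 * (p\<^sup>2 / 4 + K2 + N2)"
    using split[of 2] unfolding K2' N2_def by simp
  have "c \<alpha> \<beta> + c \<beta> \<alpha> = (\<alpha> / 2 * (p + U) + \<beta> / 2 * V - K)\<^sup>2 + (\<beta> / 2 * (p + U) + \<alpha> / 2 * V - K)\<^sup>2
      - (\<alpha>\<^sup>2 + \<beta>\<^sup>2) / 4 * (gharm 2 (Suc n) ((x - 1) / 2) + gharm 2 n (x / 2)) + 2 * (p\<^sup>2 / 4 + K2)"
    unfolding c_def A K2' V_def K_def by (simp add: field_simps)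
  \<comment> \<open>By \<open>UV\<close> the mean of p + U and V is K + N, so subtracting K leaves
    N. The two brackets differ only in the sign of the \<delta>-term, and their cross terms cancel
    after squaring.\<close>
  also have "\<alpha> / 2 * (p + U) + \<beta> / 2 * V - K = N + \<delta> / 2 * (p + U - V)"
    unfolding \<alpha>_def \<beta>_def UV by (simp add: field_simps)
  also have "\<beta> / 2 * (p + U) + \<alpha> / 2 * V - K = N - \<delta> / 2 * (p + U - V)"
    unfolding \<alpha>_def \<beta>_def UV by (simp add: field_simps)
  also have "(N + \<delta> / 2 * (p + U - V))\<^sup>2 + (N - \<delta> / 2 * (p + U - V))\<^sup>2
      = 2 * N\<^sup>2 + \<delta>\<^sup>2 / 2 * (p + U - V)\<^sup>2"
    by (simp add: power2_eq_square field_simps)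
  finally have "c \<alpha> \<beta> + c \<beta> \<alpha> = 2 * N\<^sup>2 - (p + U - V)\<^sup>2 / 4 + p\<^sup>2 / 4 + K2 - N2"
    unfolding \<delta> \<alpha>\<beta> Q by (simp add: add_divide_distrib diff_divide_distrib)
  \<comment> \<open>Uses (p + U - V)^2 - p^2 = (V - U) (V - U - 2p).\<close>
  also have "\<dots> = (4 * K2 - 4 * N2 + 8 * N\<^sup>2 - (V - U) * (V - U - 2 * p)) / 4"
    by (simp add: power2_eq_square field_simps)
  finally have "B / 2 * (c \<alpha> \<beta> + c \<beta> \<alpha>)
      = B / 8 * (4 * K2 - 4 * N2 + 8 * N\<^sup>2 - (V - U) * (V - U - 2 * p))"
    by (simp only:) simp
  hence cc: "B / 2 * c \<alpha> \<beta> + B / 2 * c \<beta> \<alpha>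
      = B / 8 * (4 * K2 - 4 * N2 + 8 * N\<^sup>2 - (V - U) * (V - U - 2 * p))"
    by (simp only: distrib_left)
  \<comment> \<open>For \<open>k \<le> n\<close> the natural subtraction 2n - k is not
    truncated.\<close>
  have "(2 * of_nat n - of_nat k) gchoose n = (of_nat ((2 * n - k) choose n) :: complex)" if "k \<le> n" for k
    using that by (simp add: binomial_gbinomial of_nat_diff)
  hence "(\<Sum>k=0..n. ((2 * of_nat n - of_nat k) gchoose n) * ((x + of_nat k) gchoose k) * (harm1 k x)\<^sup>2)
      = (\<Sum>k=0..n. of_nat ((2 * n - k) choose n) * ((x + of_nat k) gchoose k) * (harm1 k x)\<^sup>2)"
    by (intro sum.cong) auto
  thus ?thesis
    unfolding main cc unfolding B_def K2_def N2_def N_def V_def U_def p_def by simp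
qed

end
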